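(* In dynamic rings with no chirality, Gathering is impossible without knowledge of $n$ when starting from a configuration $C\in\mathcal{E}$; that is, no algorithm whose agents do not know the ring size $n$ solves Gathering when starting from the configurations $C\in\mathcal{E}$. This holds even if there is cross detection and the number $k$ of agents is known to the agents.
   Context: Dynamic ring. $\mathcal{R}=(v_0,\dots,v_{n-1})$ is a ring of $n$ anonymous nodes; $v_i$ is joined to $v_{i-1}$ and $v_{i+1}$ (indices modulo $n$) through two distinctly labeled ports $q_{i-}$, $q_{i+}$; the labeling is arbitrary and need not give a globally consistent orientation. Each port has an incoming and an outgoing buffer. Time proceeds in synchronous rounds; in each round an adversarial scheduler, not restricted by any fairness assumption, chooses which edge (at most one) is missing (1-interval connectivity). Agents. There are $k$ anonymous agents, each with its own memory and computational capability, all executing the same deterministic protocol. They start at distinct nodes, called homebases; homebases are identically marked, so an agent can tell whether its current node is a homebase. Several agents may be in the same node; an agent sees how many other agents are in its node and where (at the node, in which incoming or outgoing buffer). Agents have no explicit communication. Each agent has a private orientation of the ring, consistent over all nodes, designating at each node one port as left and the other as right; different agents may have different orientations. There is chirality if all agents are guaranteed to agree on the orientation; without chirality there is no such guarantee. There is cross detection if, whenever agents move in opposite directions on the same edge in the same round, the involved agents detect this event (not necessarily knowing how many agents are involved). Not knowing $n$ means that the protocol does not receive $n$: the same protocol is run on rings of all sizes. Rounds. In each round each agent, based on the number of agents at its node and in the buffers, its memory and its state, chooses a direction in $\{left,right,nil\}$. With $nil$ it places itself at the node. Otherwise it moves to the outgoing buffer of the chosen port; if the edge is present, it arrives in the incoming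 buffer of the corresponding port of the neighbouring node in the next round; if the edge is missing it stays in the outgoing buffer. There is an initial state and a terminal state. Gathering. Gathering is achieved in a round if all agents are on the same node or on two neighbouring nodes. An algorithm solves Gathering from a configuration if, for every adversarial schedule and every admissible choice of port labels and private orientations, within finite time all agents are in the terminal state, are gathered, and are aware that gathering has been achieved. Configurations. A configuration is the set of locations of the $k$ homebases in the ring. Let $h_0,\dots,h_{k-1}$ be the homebases in clockwise order and $d_i$ the number of edges between $h_i$ and $h_{i+1}$ (indices modulo $k$). The configuration is periodic if there is $p$ with $p\mid k$, $p<k$, and $d_i=d_{i+p}$ for all $i$. Let $\delta^{+j}=\langle d_j,d_{j+1},\dots,d_{j+k-1}\rangle$ and $\delta^{-j}=\langle d_{j-1},d_{j-2},\dots,d_{j-k}\rangle$, and let $\delta_{min}$ be the lexicographically minimum sequence among all $\delta^{+j},\delta^{-j}$, $0\le j\le k-1$. A non-periodic configuration is double-palindrome if $\delta_{min}=\delta^{+i}=\delta^{-j}$ with $i\ne j$; it then has a unique axis of symmetry, equidistant from $h_i$ and $h_j$. If this axis passes through two edges (i.e. the two distances along the ring between $h_i$ and $h_j$ are both odd) the configuration is edge-edge; $\mathcal{E}$ is the set of edge-edge configurations. *)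

theory Defs
  imports Main "HOL-Library.List_Lexorder"
begin

subsection \<open>Homebase configurations\<close>

text \<open>A configuration is a pair \<open>(n, H)\<close>: the nodes of the ring are \<open>0, \<dots>, n - 1\<close>, clockwise, and
  \<open>H\<close> is the set of homebases, so the number of agents is \<open>card H\<close>.\<close>

type_synonym config = "nat \<times> nat set"

definition ring_config :: "nat \<Rightarrow> nat set \<Rightarrow> bool" where
  "ring_config n H \<longleftrightarrow> 3 \<le> n \<and> H \<subseteq> {..<n} \<and> H \<noteq> {}"

definition homebase :: "nat set \<Rightarrow> nat \<Rightarrow> nat" where
  "homebase H i = sorted_list_of_set H ! (i mod card H)"

definition cw_dist :: "nat \<Rightarrow> nat \<Rightarrow> nat \<Rightarrow> nat" where
  "cw_dist n u v = (if u < v then v - u else n + v - u)"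

definition gap :: "nat \<Rightarrow> nat set \<Rightarrow> nat \<Rightarrow> nat" where
  "gap n H i = cw_dist n (homebase H i) (homebase H (Suc i))"

definition periodic :: "nat \<Rightarrow> nat set \<Rightarrow> bool" where
  "periodic n H \<longleftrightarrow> (\<exists>p. p dvd card H \<and> p < card H \<and> (\<forall>i. gap n H i = gap n H (i + p)))"

definition delta_plus :: "nat \<Rightarrow> nat set \<Rightarrow> nat \<Rightarrow> nat list" where
  "delta_plus n H j = map (\<lambda>m. gap n H (j + m)) [0..<card H]"

text \<open>The \<open>m\<close>-th entry is the gap with index \<open>j - 1 - m\<close>; adding \<open>card H\<close> keeps the index a natural
  number and leaves the gap unchanged.\<close>

definition delta_minus :: "nat \<Rightarrow> nat set \<Rightarrow> nat \<Rightarrow> nat list" where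
  "delta_minus n H j = map (\<lambda>m. gap n H (j + card H - 1 - m)) [0..<card H]"

definition delta_min :: "nat \<Rightarrow> nat set \<Rightarrow> nat list" where
  "delta_min n H = Min (delta_plus n H ` {..<card H} \<union> delta_minus n H ` {..<card H})"

text \<open>In a non-periodic configuration \<open>i\<close> and \<open>j\<close> below are unique, so that \<open>edge_edge\<close> and
  \<open>double_palindrome\<close> speak about the same pair of homebases.\<close>

definition min_pair :: "nat \<Rightarrow> nat set \<Rightarrow> nat \<Rightarrow> nat \<Rightarrow> bool" where
  "min_pair n H i j \<longleftrightarrow> i < card H \<and> j < card H \<and> i \<noteq> j \<and>
     delta_min n H = delta_plus n H i \<and> delta_min n H = delta_minus n H j"

definition double_palindrome :: "nat \<Rightarrow> nat set \<Rightarrow> bool" where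
  "double_palindrome n H \<longleftrightarrow> \<not> periodic n H \<and> (\<exists>i j. min_pair n H i j)"

definition edge_edge :: "nat \<Rightarrow> nat set \<Rightarrow> bool" where
  "edge_edge n H \<longleftrightarrow> double_palindrome n H \<and>
     (\<exists>i j. min_pair n H i j \<and>
        odd (cw_dist n (homebase H i) (homebase H j)) \<and>
        odd (cw_dist n (homebase H j) (homebase H i)))"

definition edge_edge_configs :: "config set" where
  "edge_edge_configs = {(n, H). ring_config n H \<and> edge_edge n H}"

subsection \<open>The ring\<close>

text \<open>Port \<open>Minus\<close> of node \<open>i\<close> leads to node \<open>i - 1\<close>, port \<open>Plus\<close> to node \<open>i + 1\<close>, modulo \<open>n\<close>. These
  names are not visible to the agents. Edge \<open>j\<close> joins the nodes \<open>j\<close> and \<open>j + 1\<close>, modulo \<open>n\<close>.\<close>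

datatype port = Minus | Plus

fun opposite :: "port \<Rightarrow> port" where
  "opposite Minus = Plus"
| "opposite Plus = Minus"

fun neighbour :: "nat \<Rightarrow> port \<Rightarrow> nat \<Rightarrow> nat" where
  "neighbour n Minus i = (i + n - 1) mod n"
| "neighbour n Plus i = (i + 1) mod n"

fun port_edge :: "nat \<Rightarrow> port \<Rightarrow> nat \<Rightarrow> nat" where
  "port_edge n Minus i = (i + n - 1) mod n"
| "port_edge n Plus i = i"

text \<open>A labeling puts distinct visible labels on the two ports of each node. Two labels are enough:
  a protocol that copes with every labeling over a larger alphabet copes in particular with these.\<close>

type_synonym labeling = "nat \<Rightarrow> port \<Rightarrow> bool"

definition valid_labeling :: "labeling \<Rightarrow> bool" where
  "valid_labeling lab \<longleftrightarrow> (\<forall>i. lab i Minus \<noteq> lab i Plus)"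

text \<open>A schedule gives for each round the missing edge, if any.\<close>

type_synonym schedule = "nat \<Rightarrow> nat option"

definition valid_schedule :: "nat \<Rightarrow> schedule \<Rightarrow> bool" where
  "valid_schedule n S \<longleftrightarrow> (\<forall>t. set_option (S t) \<subseteq> {..<n})"

subsection \<open>Agents and protocols\<close>

datatype side = Left | Right

text \<open>A private orientation is given by the port called left. It is the same port at all nodes, which
  makes the orientation consistent along the ring.\<close>

fun port_of :: "port \<Rightarrow> side \<Rightarrow> port" where
  "port_of l Left = l"
| "port_of l Right = opposite l"

definition side_of :: "port \<Rightarrow> port \<Rightarrow> side" where
  "side_of l q = (if q = l then Left else Right)"

datatype 'p place = At_Node | Incoming 'p | Outgoing 'p

text \<open>What an agent perceives in one round, in terms of its own orientation; \<open>others p\<close> is the number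
  of other agents at place \<open>p\<close> of the current node.\<close>

record view =
  own_place :: "side place"
  others :: "side place \<Rightarrow> nat"
  on_homebase :: bool
  label_at :: "side \<Rightarrow> bool"
  cross_detected :: bool

text \<open>The direction \<open>nil\<close> is \<open>None\<close>. The memory of an agent is part of its state, and the type \<open>'s\<close>
  of states may be infinite.\<close>

record 's protocol =
  init :: 's
  terminal :: 's
  trans :: "'s \<Rightarrow> view \<Rightarrow> 's \<times> side option"

text \<open>\<open>crossed\<close> records whether in the previous round the agent traversed an edge that some other
  agent traversed in the opposite direction.\<close>

record 's agent =
  node :: nat
  place :: "port place"
  state :: 's
  crossed :: bool

subsection \<open>Executions\<close>

text \<open>The agents are anonymous; only in the model are they identified, by their homebases. A global
  state thus maps homebases to agents.\<close>

type_synonym 's global = "nat \<Rightarrow> 's agent"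

definition look ::
  "bool \<Rightarrow> nat set \<Rightarrow> labeling \<Rightarrow> (nat \<Rightarrow> port) \<Rightarrow> 's global \<Rightarrow> nat \<Rightarrow> view" where
  "look cd H lab ori g a =
     \<lparr> own_place = map_place (side_of (ori a)) (place (g a)),
       others = (\<lambda>p. card {b \<in> H. b \<noteq> a \<and> node (g b) = node (g a) \<and>
                              map_place (side_of (ori a)) (place (g b)) = p}),
       on_homebase = (node (g a) \<in> H),
       label_at = (\<lambda>s. lab (node (g a)) (port_of (ori a) s)),
       cross_detected = (cd \<and> crossed (g a)) \<rparr>"

definition decide ::
  "bool \<Rightarrow> 's protocol \<Rightarrow> nat set \<Rightarrow> labeling \<Rightarrow> (nat \<Rightarrow> port) \<Rightarrow> 's global \<Rightarrow> nat \<Rightarrow> 's \<times> side option" where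
  "decide cd P H lab ori g a =
     (if state (g a) = terminal P then (terminal P, None)
      else trans P (state (g a)) (look cd H lab ori g a))"

definition exit_port ::
  "bool \<Rightarrow> 's protocol \<Rightarrow> nat set \<Rightarrow> labeling \<Rightarrow> (nat \<Rightarrow> port) \<Rightarrow> 's global \<Rightarrow> nat \<Rightarrow> port option" where
  "exit_port cd P H lab ori g a = map_option (port_of (ori a)) (snd (decide cd P H lab ori g a))"

definition step ::
  "bool \<Rightarrow> 's protocol \<Rightarrow> nat \<Rightarrow> nat set \<Rightarrow> labeling \<Rightarrow> (nat \<Rightarrow> port) \<Rightarrow> nat option \<Rightarrow>
   's global \<Rightarrow> 's global" where
  "step cd P n H lab ori missing g = (\<lambda>a.
     let i = node (g a);
         s = fst (decide cd P H lab ori g a);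
         out = exit_port cd P H lab ori g
     in case out a of
          None \<Rightarrow> \<lparr> node = i, place = At_Node, state = s, crossed = False \<rparr>
        | Some q \<Rightarrow>
            if missing = Some (port_edge n q i)
            then \<lparr> node = i, place = Outgoing q, state = s, crossed = False \<rparr>
            else \<lparr> node = neighbour n q i, place = Incoming (opposite q), state = s,
                   crossed = (\<exists>b\<in>H. node (g b) = neighbour n q i \<and> out b = Some (opposite q)) \<rparr>)"

fun run ::
  "bool \<Rightarrow> 's protocol \<Rightarrow> nat \<Rightarrow> nat set \<Rightarrow> labeling \<Rightarrow> (nat \<Rightarrow> port) \<Rightarrow> schedule \<Rightarrow>
   nat \<Rightarrow> 's global" where
  "run cd P n H lab ori S 0 =
     (\<lambda>a. \<lparr> node = a, place = At_Node, state = init P, crossed = False \<rparr>)"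
| "run cd P n H lab ori S (Suc t) = step cd P n H lab ori (S t) (run cd P n H lab ori S t)"

subsection \<open>Gathering\<close>

text \<open>The case that not both of the two neighbouring nodes are occupied is gathering on one node.\<close>

definition gathered :: "nat \<Rightarrow> nat set \<Rightarrow> 's global \<Rightarrow> bool" where
  "gathered n H g \<longleftrightarrow> (\<exists>v<n. \<forall>a\<in>H. node (g a) = v \<or> node (g a) = neighbour n Plus v)"

text \<open>Absence of chirality: the private orientations \<open>ori\<close> are arbitrary. The agents are aware that
  gathering has been achieved by being in the terminal state, which they never leave and in which
  they do not change nodes. An agent may enter this state before the others arrive; a
  definition that excludes this asks more of the protocol.\<close>

definition solves_gathering :: "bool \<Rightarrow> 's protocol \<Rightarrow> nat \<Rightarrow> nat set \<Rightarrow> bool" where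
  "solves_gathering cd P n H \<longleftrightarrow>
     (\<forall>S lab ori. valid_schedule n S \<longrightarrow> valid_labeling lab \<longrightarrow>
        (\<exists>t. (\<forall>a\<in>H. state (run cd P n H lab ori S t a) = terminal P) \<and>
             gathered n H (run cd P n H lab ori S t)))"

text \<open>An algorithm whose agents know their number \<open>k\<close> but not the size of the ring is a family of
  protocols indexed by \<open>k\<close> alone. If the agents do not know \<open>k\<close> either, the family is constant.\<close>

type_synonym 's k_algorithm = "nat \<Rightarrow> 's protocol"

definition solves_from :: "bool \<Rightarrow> 's k_algorithm \<Rightarrow> config \<Rightarrow> bool" where
  "solves_from cd A C = (case C of (n, H) \<Rightarrow> solves_gathering cd (A (card H)) n H)"

end

theory Submission
  imports Defs
begin

text \<open>Two agents suffice. Place them at adjacent nodes of the ring of size 4, with opposite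
  orientations. As long as the adversary removes one of the two edges on the axis of symmetry
  whenever the agents are about to cross it, both agents perform the same solitary walk between
  their homebase and the node behind it: nobody is ever met, no crossing occurs, and the other
  homebase is never seen. Since Gathering is solved, this walk terminates, in some round \<open>T\<close>. In a
  ring whose size is large compared to \<open>T\<close>, with the other agent far away in both directions, the
  adversary spends its missing edge on one agent alone and enforces the same walk, so that this
  agent terminates in round \<open>T\<close>. From then on the adversary blocks every move of the other agent,
  which never arrives. The size of the ring being unknown, the two situations have to be
  handled by the same protocol.\<close>

subsection \<open>Edge-edge configurations of two agents\<close>

lemma homebase_pair:
  assumes "0 < d"
  shows "homebase {0, d} i = (if even i then 0 else d)"
proof -
  have "card {0, d} = 2" "sorted_list_of_set {0, d} = [0, d]"
    using assms by auto
  then show ?thesis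
    by (auto simp: homebase_def even_iff_mod_2_eq_zero odd_iff_mod_2_eq_one)
qed

lemma gap_pair:
  assumes "0 < d" "d < n"
  shows "gap n {0, d} i = (if even i then d else n - d)"
  using assms by (auto simp: gap_def homebase_pair cw_dist_def)

text \<open>The reflection exchanging the two homebases turns \<open>delta_plus\<close> at 0 into
  \<open>delta_minus\<close> at 1; by \<open>2 * d < n\<close> the gaps differ, which excludes
  periodicity and fixes the minimum.\<close>

lemma pair_edge_edge:
  assumes "0 < d" "2 * d < n" "odd d" "even n"
  shows "(n, {0, d}) \<in> edge_edge_configs"
proof -
  let ?H = "{0, d}"
  have card: "card ?H = 2" using assms by auto
  note gap = gap_pair[of d n]
  have dp: "delta_plus n ?H 0 = [d, n - d]" "delta_plus n ?H 1 = [n - d, d]"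
    and dm: "delta_minus n ?H 0 = [n - d, d]" "delta_minus n ?H 1 = [d, n - d]"
    unfolding delta_plus_def delta_minus_def card using assms
    by (simp_all add: gap upt_rec)
  have two: "{..<2::nat} = {0, 1}" by auto
  have min: "delta_min n ?H = [d, n - d]"
    unfolding delta_min_def card two using assms dp dm
    by (auto simp: min_def)
  have mp: "min_pair n ?H 0 1"
    unfolding min_pair_def card using min dp dm by simp
  have "\<not> periodic n ?H"
  proof
    assume "periodic n ?H"
    then obtain p where p: "p dvd 2" "p < 2" "\<And>i. gap n ?H i = gap n ?H (i + p)"
      unfolding periodic_def card by blast
    then have "p = 1" by (cases "p = 0") auto
    then show False using p(3)[of 0] assms by (simp add: gap)
  qed
  moreover have "odd (cw_dist n (homebase ?H 0) (homebase ?H 1))"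
    "odd (cw_dist n (homebase ?H 1) (homebase ?H 0))"
    using assms by (auto simp: homebase_pair cw_dist_def)
  moreover have "ring_config n ?H"
    using assms by (auto simp: ring_config_def elim!: oddE evenE)
  ultimately show ?thesis
    using mp unfolding edge_edge_configs_def edge_edge_def double_palindrome_def by blast
qed

subsection \<open>The solitary walk\<close>

text \<open>The walk takes place on the homebase and its neighbour on the left. The first component of a
  \<open>walk_pos\<close> says whether the agent is at this neighbour.\<close>

type_synonym 's walk_pos = "bool \<times> side place \<times> 's"

text \<open>Labels are aligned with the private orientation, so that this view is the same in both
  rings and for either choice of the left port.\<close>

definition solo_view :: "bool \<Rightarrow> side place \<Rightarrow> view" where
  "solo_view away pl = \<lparr> own_place = pl, others = (\<lambda>_. 0), on_homebase = (\<not> away),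
     label_at = (\<lambda>s. s = Left), cross_detected = False \<rparr>"

fun walk_decide :: "'s protocol \<Rightarrow> 's walk_pos \<Rightarrow> 's \<times> side option" where
  "walk_decide P (away, pl, st) =
     (if st = terminal P then (terminal P, None) else trans P st (solo_view away pl))"

text \<open>The side leading out of the two-node stretch.\<close>

definition barred_side :: "bool \<Rightarrow> side" where
  "barred_side away = (if away then Left else Right)"

text \<open>An agent that moves left arrives from the right, and conversely. As the unbarred move is to the
  left at the homebase and to the right at the other node, it arrives on the side that was barred
  before the move.\<close>

fun walk_step :: "'s protocol \<Rightarrow> 's walk_pos \<Rightarrow> 's walk_pos" where
  "walk_step P (away, pl, st) =
     (case walk_decide P (away, pl, st) of
        (s, None) \<Rightarrow> (away, At_Node, s)
      | (s, Some d) \<Rightarrow>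
          if d = barred_side away then (away, Outgoing d, s)
          else (\<not> away, Incoming (barred_side away), s))"

fun walk :: "'s protocol \<Rightarrow> nat \<Rightarrow> 's walk_pos" where
  "walk P 0 = (False, At_Node, init P)"
| "walk P (Suc t) = walk_step P (walk P t)"

lemma walk_terminal_stable:
  assumes "snd (snd (walk P T)) = terminal P" "T \<le> t"
  shows "snd (snd (walk P t)) = terminal P"
  using assms(2)
proof (induction rule: dec_induct)
  case (step t)
  then show ?case by (cases "walk P t") auto
qed (use assms in simp)

fun embed :: "port \<Rightarrow> nat \<Rightarrow> nat \<Rightarrow> 's walk_pos \<Rightarrow> 's agent" where
  "embed p h w (away, pl, st) =
     \<lparr> node = (if away then w else h), place = map_place (port_of p) pl, state = st,
       crossed = False \<rparr>"

definition corridor :: "nat \<Rightarrow> nat set \<Rightarrow> labeling \<Rightarrow> port \<Rightarrow> nat \<Rightarrow> nat \<Rightarrow> bool" where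
  "corridor n H lab p h w \<longleftrightarrow> h \<in> H \<and> w \<notin> H \<and> neighbour n p h = w \<and>
     neighbour n (opposite p) w = h \<and> (\<forall>q. lab h q \<longleftrightarrow> q = p) \<and> (\<forall>q. lab w q \<longleftrightarrow> q = p)"

text \<open>An equivalence, because a move inside the corridor must find its edge present. An agent
  that stays leaves the adversary free.\<close>

definition enforces_walk ::
  "'s protocol \<Rightarrow> nat \<Rightarrow> port \<Rightarrow> nat \<Rightarrow> nat \<Rightarrow> 's walk_pos \<Rightarrow> nat option \<Rightarrow> bool" where
  "enforces_walk P n p h w x missing \<longleftrightarrow>
     (\<forall>d. snd (walk_decide P x) = Some d \<longrightarrow>
        (missing = Some (port_edge n (port_of p d) (if fst x then w else h)) \<longleftrightarrow>
         d = barred_side (fst x)))"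

lemma opposite_neq [simp]: "opposite p \<noteq> p" "p \<noteq> opposite p"
  by (cases p; simp)+

lemma side_of_port_of [simp]: "side_of p (port_of p s) = s"
  by (cases s) (auto simp: side_of_def)

lemma port_of_eq_left_iff [simp]: "port_of p s = p \<longleftrightarrow> s = Left"
  by (cases s) auto

lemma opposite_opposite [simp]: "opposite (opposite p) = p"
  by (cases p) auto

lemma decide_embed:
  assumes "corridor n H lab (ori a) h w" "g a = embed (ori a) h w x"
    and "\<And>b. b \<in> H \<Longrightarrow> b \<noteq> a \<Longrightarrow> node (g b) \<noteq> h \<and> node (g b) \<noteq> w"
  shows "decide cd P H lab ori g a = walk_decide P x"
proof -
  obtain away pl st where x: "x = (away, pl, st)" by (cases x)
  have nd: "node (g a) = (if away then w else h)" using assms(2) x by simp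
  have "{b \<in> H. b \<noteq> a \<and> node (g b) = node (g a) \<and> Q b} = {}" for Q
    using assms(3) nd by auto
  then have alone: "card {b \<in> H. b \<noteq> a \<and> node (g b) = node (g a) \<and> Q b} = 0" for Q
    by (simp only: card.empty)
  have "look cd H lab ori g a = solo_view away pl"
    using assms(1,2) unfolding look_def alone solo_view_def corridor_def
    by (simp add: x place.map_comp comp_def place.map_ident)
  then show ?thesis using assms(2) by (simp add: decide_def x)
qed

lemma step_embed:
  assumes cor: "corridor n H lab (ori a) h w" and ga: "g a = embed (ori a) h w x"
    and away: "\<And>b. b \<in> H \<Longrightarrow> b \<noteq> a \<Longrightarrow> node (g b) \<noteq> h \<and> node (g b) \<noteq> w"
    and enf: "enforces_walk P n (ori a) h w x missing"
  shows "step cd P n H lab ori missing g a = embed (ori a) h w (walk_step P x)"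
proof -
  obtain aw pl st where x: "x = (aw, pl, st)" by (cases x)
  obtain s m where d: "walk_decide P x = (s, m)" by fastforce
  have dec: "decide cd P H lab ori g a = (s, m)"
    using decide_embed[of n H lab ori a h w g x] cor ga away d by simp
  have nd: "node (g a) = (if aw then w else h)" using ga x by simp
  have hw: "h \<noteq> w" using cor by (auto simp: corridor_def)
  show ?thesis
  proof (cases m)
    case None
    then show ?thesis using d dec nd by (simp add: step_def exit_port_def x)
  next
    case (Some e)
    have bl: "missing = Some (port_edge n (port_of (ori a) e) (node (g a))) \<longleftrightarrow>
        e = barred_side aw"
      using enf d Some nd by (simp add: enforces_walk_def x)
    show ?thesis
    proof (cases "e = barred_side aw")
      case True
      then show ?thesis using bl d dec nd Some by (simp add: step_def exit_port_def x)
    next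
      case False
      then have e: "e = (if aw then Right else Left)"
        by (cases e) (auto simp: barred_side_def split: if_splits)
      then have nb: "neighbour n (port_of (ori a) e) (node (g a)) = (if aw then h else w)"
        using cor nd by (auto simp: corridor_def)
      \<comment> \<open>The target node holds no agent, the walker being at the other end of the
        corridor, so no crossing is recorded.\<close>
      have "\<forall>b\<in>H. node (g b) \<noteq> neighbour n (port_of (ori a) e) (node (g a))"
        unfolding nb using away nd hw by (metis (full_types))
      then have "step cd P n H lab ori missing g a =
          \<lparr> node = neighbour n (port_of (ori a) e) (node (g a)),
            place = Incoming (opposite (port_of (ori a) e)), state = s, crossed = False \<rparr>"
        using bl False dec Some by (simp add: step_def exit_port_def Let_def)
      then show ?thesis
        using nb e d Some by (cases aw) (simp_all add: barred_side_def x)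
    qed
  qed
qed

lemma step_node:
  "node (step cd P n H lab ori missing g a) = node (g a) \<or>
   (\<exists>q. exit_port cd P H lab ori g a = Some q \<and> missing \<noteq> Some (port_edge n q (node (g a))) \<and>
      node (step cd P n H lab ori missing g a) = neighbour n q (node (g a)))"
  by (auto simp: step_def Let_def split: option.splits)

text \<open>The protocol being deterministic, recursion on rounds turns a strategy \<open>f\<close>
  that reacts to the current global state into a fixed schedule.\<close>

lemma adaptive_schedule:
  obtains S where "\<And>t. S t = f t (run cd P n H lab ori S t)"
proof -
  define G where "G = rec_nat (run cd P n H lab ori (\<lambda>_. None) 0)
    (\<lambda>t g. step cd P n H lab ori (f t g) g)"
  define S where "S t = f t (G t)" for t
  have "run cd P n H lab ori S t = G t" for t
    by (induction t) (simp_all add: G_def S_def)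
  then show thesis using that[of S] by (simp add: S_def)
qed

text \<open>Here \<open>e\<close> is meant as the edge beyond the homebase and \<open>f\<close> as
  the edge beyond its neighbour.\<close>

definition bar :: "'s protocol \<Rightarrow> nat \<Rightarrow> nat \<Rightarrow> 's walk_pos \<Rightarrow> nat option" where
  "bar P e f x =
     (if snd (walk_decide P x) = Some (barred_side (fst x)) then Some (if fst x then f else e)
      else None)"

lemma enforces_walk_bar:
  assumes "port_edge n (opposite p) h = e" "port_edge n p w = f"
  shows "enforces_walk P n p h w x (bar P e f x)"
  using assms by (auto simp: enforces_walk_def bar_def barred_side_def)

subsection \<open>The two rings\<close>

text \<open>The agents stay mirror images of each other, so they attempt a barred move in the same
  round and over the same edge, 0 or 2: one missing edge stops both.\<close>

lemma walk_terminates: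
  assumes "solves_gathering cd P 4 {0, 1}"
  obtains T where "snd (snd (walk P T)) = terminal P"
proof -
  define lab :: labeling where
    "lab = (\<lambda>i q. q = (if i = 1 \<or> i = 2 then Plus else Minus))"
  define ori :: "nat \<Rightarrow> port" where "ori = (\<lambda>a. if a = 0 then Minus else Plus)"
  define S where "S t = bar P 0 2 (walk P t)" for t
  let ?r = "run cd P 4 {0, 1} lab ori S"
  have cor: "corridor 4 {0, 1} lab (ori 0) 0 3" "corridor 4 {0, 1} lab (ori 1) 1 2"
    by (auto simp: corridor_def lab_def ori_def)
  have enf: "enforces_walk P 4 (ori 0) 0 3 (walk P t) (S t)"
    "enforces_walk P 4 (ori 1) 1 2 (walk P t) (S t)" for t
    unfolding S_def by (intro enforces_walk_bar; simp add: ori_def)+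
  have inv: "?r t 0 = embed (ori 0) 0 3 (walk P t) \<and> ?r t 1 = embed (ori 1) 1 2 (walk P t)" for t
  proof (induction t)
    case (Suc t)
    have n0: "node (?r t 0) \<in> {0, 3}" and n1: "node (?r t 1) \<in> {1, 2}"
      using Suc by (cases "walk P t"; simp)+
    have "step cd P 4 {0, 1} lab ori (S t) (?r t) 0 = embed (ori 0) 0 3 (walk_step P (walk P t))"
      by (rule step_embed[where ori = ori and a = 0, OF cor(1) _ _ enf(1)]) (use Suc n1 in auto)
    moreover have
      "step cd P 4 {0, 1} lab ori (S t) (?r t) 1 = embed (ori 1) 1 2 (walk_step P (walk P t))"
      by (rule step_embed[where ori = ori and a = 1, OF cor(2) _ _ enf(2)]) (use Suc n0 in auto)
    ultimately show ?case by simp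
  qed simp
  have "valid_schedule 4 S" "valid_labeling lab"
    by (auto simp: valid_schedule_def valid_labeling_def lab_def S_def bar_def)
  then obtain T where "state (?r T 1) = terminal P"
    using assms unfolding solves_gathering_def by blast
  then have "snd (snd (walk P T)) = terminal P"
    using inv[of T] by (cases "walk P T") simp
  then show thesis using that by blast
qed

text \<open>The agent from \<open>d\<close> makes at most \<open>T\<close> moves, too few to come
  near the nodes 0 and 1 on either side. The factor 2 in \<open>d\<close> keeps it odd for every
  \<open>T\<close>.\<close>

lemma large_ring_not_gathered:
  fixes P :: "'s protocol"
  assumes halts: "snd (snd (walk P T)) = terminal P"
    and d: "d = 2 * T + 5" and n: "n = 2 * d + 2"
  shows "\<not> solves_gathering cd P n {0, d}"
proof
  assume sol: "solves_gathering cd P n {0, d}"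
  let ?H = "{0, d}"
  define lab :: labeling where "lab = (\<lambda>i q. q = Plus)"
  define ori :: "nat \<Rightarrow> port" where "ori = (\<lambda>a. Plus)"
  \<comment> \<open>The reduction \<open>mod n\<close> makes the schedule valid before any bound on
    the node of the agent is known.\<close>
  define f :: "nat \<Rightarrow> 's global \<Rightarrow> nat option" where
    "f t g = (if t < T then bar P (n - 1) 1 (walk P t)
       else map_option (\<lambda>q. port_edge n q (node (g d)) mod n) (exit_port cd P ?H lab ori g d))"
    for t g
  obtain S where S: "\<And>t. S t = f t (run cd P n ?H lab ori S t)"
    using adaptive_schedule by blast
  let ?r = "run cd P n ?H lab ori S"
  have n14: "n > 11" using n d by simp
  have cor: "corridor n ?H lab (ori 0) 0 1"
    using n14 d by (auto simp: corridor_def lab_def ori_def)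
  have enf: "enforces_walk P n (ori 0) 0 1 (walk P t) (S t)" for t
  proof (cases "t < T")
    case True
    then have "S t = bar P (n - 1) 1 (walk P t)" using S[of t] by (simp add: f_def)
    then show ?thesis
      using enforces_walk_bar[of n "ori 0" 0 "n - 1" 1 1] n14 by (simp add: ori_def)
  next
    case False
    then have "snd (snd (walk P t)) = terminal P" using walk_terminal_stable[OF halts] by simp
    \<comment> \<open>A halted agent attempts no move, so any missing edge is compatible with its
      walk.\<close>
    then show ?thesis by (cases "walk P t") (simp add: enforces_walk_def)
  qed
  \<comment> \<open>The term \<open>min t T\<close> records a drift of at most one node per round
    before round \<open>T\<close> and none afterwards.\<close>
  have inv: "?r t 0 = embed (ori 0) 0 1 (walk P t) \<and>
      d \<le> node (?r t d) + min t T \<and> node (?r t d) \<le> d + min t T" for t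
  proof (induction t)
    case (Suc t)
    let ?i = "node (?r t d)"
    have lo: "5 \<le> ?i" and hi: "?i + 5 < n" using Suc d n by auto
    have "step cd P n ?H lab ori (S t) (?r t) 0 = embed (ori 0) 0 1 (walk_step P (walk P t))"
      by (rule step_embed[where ori = ori and a = 0, OF cor _ _ enf]) (use Suc lo in auto)
    moreover have "d \<le> node (?r (Suc t) d) + min (Suc t) T \<and> node (?r (Suc t) d) \<le> d + min (Suc t) T"
      using step_node[of cd P n ?H lab ori "S t" "?r t" d]
    proof (elim disjE exE conjE)
      fix q
      assume q: "exit_port cd P ?H lab ori (?r t) d = Some q"
        "S t \<noteq> Some (port_edge n q ?i)"
        "node (step cd P n ?H lab ori (S t) (?r t) d) = neighbour n q ?i"
      have "port_edge n q ?i mod n = port_edge n q ?i" using hi by (cases q) auto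
      then have "t < T" using q(1,2) S[of t] by (auto simp: f_def split: if_splits)
      moreover have "neighbour n q ?i = ?i - 1 \<or> neighbour n q ?i = ?i + 1"
        using lo hi by (cases q) (auto simp: mod_if)
      ultimately show ?thesis using q(3) Suc lo by auto
    qed (use Suc in auto)
    ultimately show ?case by simp
  qed simp
  have "valid_schedule n S" "valid_labeling lab"
    using n14 S by (auto simp: valid_schedule_def valid_labeling_def lab_def f_def bar_def)
  then obtain t where "gathered n ?H (?r t)"
    using sol unfolding solves_gathering_def by blast
  then obtain v where v: "v < n" "node (?r t 0) = v \<or> node (?r t 0) = (v + 1) mod n"
      "node (?r t d) = v \<or> node (?r t d) = (v + 1) mod n"
    unfolding gathered_def by auto
  have "node (?r t 0) \<le> 1" using inv[of t] by (cases "walk P t") auto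
  moreover have "5 \<le> node (?r t d)" "node (?r t d) + 5 < n" using inv[of t] d n by auto
  \<comment> \<open>The case \<open>v + 1 = n\<close> is the pair of nodes \<open>n - 1\<close> and
    0, where the modulus wraps around.\<close>
  ultimately show False using v by (cases "v + 1 = n") auto
qed

theorem theorem2:
  fixes cross_detection :: bool
  shows "\<nexists>A :: 's k_algorithm. \<forall>C \<in> edge_edge_configs. solves_from cross_detection A C"
proof
  assume "\<exists>A :: 's k_algorithm. \<forall>C \<in> edge_edge_configs. solves_from cross_detection A C"
  then obtain A :: "'s k_algorithm"
    where A: "\<And>C. C \<in> edge_edge_configs \<Longrightarrow> solves_from cross_detection A C" by blast
  \<comment> \<open>There are two agents whatever \<open>n\<close> and \<open>d\<close> are, so the
    single protocol \<open>A 2\<close> faces both rings.\<close>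
  have solves: "solves_gathering cross_detection (A 2) n {0, d}"
    if "0 < d" "2 * d < n" "odd d" "even n" for n d
  proof -
    have "card {0, d} = 2" using that by simp
    then show ?thesis
      using A[OF pair_edge_edge[OF that]] by (simp add: solves_from_def del: card_insert_disjoint)
  qed
  obtain T where T: "snd (snd (walk (A 2) T)) = terminal (A 2)"
    using walk_terminates[OF solves[of 1 4]] by auto
  have "solves_gathering cross_detection (A 2) (2 * (2 * T + 5) + 2) {0, 2 * T + 5}"
    by (rule solves) simp_all
  then show False
    using large_ring_not_gathered[OF T refl refl] by blast
qed

end
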